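(* For every integer $k_2\geq 1$ and every real $\alpha_0$ with $0<\alpha_0<1$ there exist (i) a family $\{B_+^{(\ell_i)}\}_{i=0}^{k_2-1}$ of Bergman-like weighted shifts, and (ii) a subnormal weighted shift $W_\beta:=shift(\beta_0,\beta_1,\beta_2,\cdots)$ with $\beta_n<\beta_{n+1}$ for all $n\geq 0$, such that the commuting $2$-variable weighted shift $\mathbf{T}$ whose first $k_2$ rows (levels $0,1,\dots,k_2-1$) are $B_+^{(\ell_0)},\cdots,B_+^{(\ell_{k_2-1})}$, whose remaining rows are all $S_{\alpha_0}$, and whose $0$-th column is given by $W_\beta$, is (jointly) hyponormal.
   Context: $shift(\omega_0,\omega_1,\dots)$ denotes the unilateral weighted shift on $\ell^2(\mathbb{Z}_+)$, $e_k\mapsto\omega_ke_{k+1}$, with bounded positive weights. For $\ell\geq1$, the Bergman-like weighted shift is $B_+^{(\ell)}:=shift(\{\sqrt{\ell-\frac{1}{k+2}}\}_{k\geq0})$. For $0<a<1$, $S_a:=shift(a,1,1,\dots)$. For bounded families of positive numbers $\{\alpha_{\mathbf{k}}\},\{\beta_{\mathbf{k}}\}$, $\mathbf{k}\in\mathbb{Z}_+^2$, the $2$-variable weighted shift $\mathbf{T}\equiv(T_1,T_2)$ on $\ell^2(\mathbb{Z}_+^2)$ is defined by $T_1e_{\mathbf{k}}=\alpha_{\mathbf{k}}e_{\mathbf{k}+\boldsymbol{\varepsilon}_1}$, $T_2e_{\mathbf{k}}=\beta_{\mathbf{k}}e_{\mathbf{k}+\boldsymbol{\varepsilon}_2}$,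 with $\boldsymbol{\varepsilon}_1=(1,0)$, $\boldsymbol{\varepsilon}_2=(0,1)$. It is commuting iff $\beta_{\mathbf{k}+\boldsymbol{\varepsilon}_1}\alpha_{\mathbf{k}}=\alpha_{\mathbf{k}+\boldsymbol{\varepsilon}_2}\beta_{\mathbf{k}}$ for all $\mathbf{k}$. The row at level $j$ is $shift(\alpha_{(0,j)},\alpha_{(1,j)},\dots)$ and the $0$-th column is $shift(\beta_{(0,0)},\beta_{(0,1)},\dots)$; a commuting $2$-variable weighted shift is determined by all its rows and its $0$-th column, via the commutativity relation. With $[S,T]:=ST-TS$, a commuting pair is (jointly) hyponormal if the operator matrix $\begin{pmatrix}[T_1^*,T_1]&[T_2^*,T_1]\\ [T_1^*,T_2]&[T_2^*,T_2]\end{pmatrix}$ is positive on the direct sum of two copies of the space. An operator is subnormal if it is the restriction of a normal operator to an invariant subspace. *)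

theory Defs
  imports "HOL-Analysis.Analysis"
begin

section \<open>The complex Hilbert space of square-summable families\<close>

typedef 'i ell2 = "{f :: 'i \<Rightarrow> complex. (\<lambda>i. (cmod (f i))\<^sup>2) summable_on UNIV}"
  morphisms coord Abs_ell2
  by (rule exI[of _ "\<lambda>_. 0"]) simp

lemma square_summable_coord: "(\<lambda>i. (cmod (coord f i))\<^sup>2) summable_on UNIV"
  using coord[of f] by simp

lemma coord_Abs_ell2:
  "(\<lambda>i. (cmod (f i))\<^sup>2) summable_on UNIV \<Longrightarrow> coord (Abs_ell2 f) = f"
  by (simp add: Abs_ell2_inverse)

lemma ell2_eqI: "(\<And>i. coord f i = coord g i) \<Longrightarrow> f = g"
  by (metis coord_inject ext)

lemma summable_coord_mult:
  "(\<lambda>i. coord f i * cnj (coord g i)) summable_on UNIV"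
proof (rule abs_summable_summable, rule abs_summable_product)
  show "(\<lambda>i. norm (coord f i * coord f i)) summable_on UNIV"
    using square_summable_coord[of f] by (simp add: norm_mult power2_eq_square)
  show "(\<lambda>i. norm (cnj (coord g i) * cnj (coord g i))) summable_on UNIV"
    using square_summable_coord[of g] by (simp add: norm_mult power2_eq_square)
qed

lemma square_summable_scale:
  "(\<lambda>i. (cmod (c * coord f i))\<^sup>2) summable_on UNIV"
  using summable_on_cmult_right[OF square_summable_coord[of f], of "(cmod c)\<^sup>2"]
  by (simp add: norm_mult power_mult_distrib)

lemma square_summable_add:
  "(\<lambda>i. (cmod (coord f i + coord g i))\<^sup>2) summable_on UNIV"
proof (rule summable_on_comparison_test)
  show "(\<lambda>i. 2 * (cmod (coord f i))\<^sup>2 + 2 * (cmod (coord g i))\<^sup>2) summable_on UNIV"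
    by (intro summable_on_add summable_on_cmult_right square_summable_coord)
  fix i
  have "(cmod (coord f i + coord g i))\<^sup>2 \<le> (cmod (coord f i) + cmod (coord g i))\<^sup>2"
    by (intro power_mono norm_triangle_ineq) simp
  also have "\<dots> \<le> 2 * (cmod (coord f i))\<^sup>2 + 2 * (cmod (coord g i))\<^sup>2"
    using sum_squares_bound[of "cmod (coord f i)" "cmod (coord g i)"]
    by (simp add: power2_sum)
  finally show "(cmod (coord f i + coord g i))\<^sup>2
      \<le> 2 * (cmod (coord f i))\<^sup>2 + 2 * (cmod (coord g i))\<^sup>2" .
qed auto

definition scaleC :: "complex \<Rightarrow> 'i ell2 \<Rightarrow> 'i ell2"  (infixr \<open>*\<^sub>C\<close> 75)
  where "c *\<^sub>C f = Abs_ell2 (\<lambda>i. c * coord f i)"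

text \<open>Linear in the first argument.\<close>

definition cinner :: "'i ell2 \<Rightarrow> 'i ell2 \<Rightarrow> complex"
  where "cinner f g = (\<Sum>\<^sub>\<infinity>i. coord f i * cnj (coord g i))"

lemma coord_scaleC [simp]: "coord (c *\<^sub>C f) i = c * coord f i"
  by (simp add: scaleC_def coord_Abs_ell2 square_summable_scale)

lemma cinner_commute: "cinner f g = cnj (cinner g f)"
  unfolding cinner_def infsum_cnj[symmetric] by (simp add: mult.commute)

lemma cinner_scaleC_left: "cinner (c *\<^sub>C f) g = c * cinner f g"
  by (simp add: cinner_def mult.assoc infsum_cmult_right')

lemma cinner_self: "cinner f f = of_real (\<Sum>\<^sub>\<infinity>i. (cmod (coord f i))\<^sup>2)"
proof -
  have "cinner f f = (\<Sum>\<^sub>\<infinity>i. of_real ((cmod (coord f i))\<^sup>2))"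
    by (simp only: cinner_def complex_norm_square)
  also have "\<dots> = of_real (\<Sum>\<^sub>\<infinity>i. (cmod (coord f i))\<^sup>2)"
    by (intro infsumI has_sum_of_real has_sum_infsum square_summable_coord)
  finally show ?thesis .
qed

instantiation ell2 :: (type) real_vector
begin

definition zero_ell2 :: "'a ell2" where "0 = Abs_ell2 (\<lambda>_. 0)"
definition plus_ell2 :: "'a ell2 \<Rightarrow> 'a ell2 \<Rightarrow> 'a ell2"
  where "f + g = Abs_ell2 (\<lambda>i. coord f i + coord g i)"
definition uminus_ell2 :: "'a ell2 \<Rightarrow> 'a ell2" where "- f = (- 1) *\<^sub>C f"
definition minus_ell2 :: "'a ell2 \<Rightarrow> 'a ell2 \<Rightarrow> 'a ell2"
  where "f - g = f + (- g)" for f g :: "'a ell2"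
definition scaleR_ell2 :: "real \<Rightarrow> 'a ell2 \<Rightarrow> 'a ell2" where "r *\<^sub>R f = of_real r *\<^sub>C f"

lemma coord_plus: "coord (f + g) i = coord f i + coord g i" for f g :: "'a ell2"
  by (simp add: plus_ell2_def coord_Abs_ell2 square_summable_add)

lemma coord_zero: "coord (0 :: 'a ell2) i = 0"
  by (simp add: zero_ell2_def coord_Abs_ell2)

instance
  by standard
    (rule ell2_eqI, simp add: coord_plus coord_zero uminus_ell2_def minus_ell2_def scaleR_ell2_def
      algebra_simps)+

end

lemma coord_add [simp]: "coord (f + g) i = coord f i + coord g i"
  by (rule coord_plus)

lemma coord_0 [simp]: "coord 0 i = 0"
  by (rule coord_zero)

lemma coord_minus [simp]: "coord (- f) i = - coord f i"
  by (simp add: uminus_ell2_def)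

lemma coord_diff [simp]: "coord (f - g) i = coord f i - coord g i"
  unfolding minus_ell2_def coord_add coord_minus by simp

lemma coord_scaleR [simp]: "coord (r *\<^sub>R f) i = of_real r * coord f i"
  by (simp add: scaleR_ell2_def)

lemma cinner_add_left: "cinner (f + g) h = cinner f h + cinner g h"
  unfolding cinner_def coord_add distrib_right
  by (intro infsum_add summable_coord_mult)

instantiation ell2 :: (type) real_inner
begin

definition inner_ell2 :: "'a ell2 \<Rightarrow> 'a ell2 \<Rightarrow> real" where "inner f g = Re (cinner f g)"
definition norm_ell2 :: "'a ell2 \<Rightarrow> real" where "norm f = sqrt (inner f f)" for f :: "'a ell2"
definition sgn_ell2 :: "'a ell2 \<Rightarrow> 'a ell2"
  where "sgn f = inverse (norm f) *\<^sub>R f" for f :: "'a ell2"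
definition dist_ell2 :: "'a ell2 \<Rightarrow> 'a ell2 \<Rightarrow> real"
  where "dist f g = norm (f - g)" for f g :: "'a ell2"
definition uniformity_ell2 :: "('a ell2 \<times> 'a ell2) filter"
  where "uniformity = (INF e\<in>{0 <..}. principal {(f :: 'a ell2, g). dist f g < e})"
definition open_ell2 :: "'a ell2 set \<Rightarrow> bool"
  where "open U \<longleftrightarrow> (\<forall>f\<in>U. eventually (\<lambda>(f', g). f' = f \<longrightarrow> g \<in> U) uniformity)"
  for U :: "'a ell2 set"

instance
proof
  fix f g h :: "'a ell2" and r :: real and U :: "'a ell2 set"
  show "sgn f = f /\<^sub>R norm f" "dist f g = norm (f - g)" "norm f = sqrt (inner f f)"
    by (simp_all add: sgn_ell2_def dist_ell2_def norm_ell2_def)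
  show "uniformity = (INF e\<in>{0 <..}. principal {(f :: 'a ell2, g). dist f g < e})"
    by (rule uniformity_ell2_def)
  show "open U \<longleftrightarrow> (\<forall>f\<in>U. eventually (\<lambda>(f', g). f' = f \<longrightarrow> g \<in> U) uniformity)"
    by (rule open_ell2_def)
  show "inner f g = inner g f"
    using cinner_commute[of f g] by (simp add: inner_ell2_def)
  show "inner (f + g) h = inner f h + inner g h"
    by (simp add: inner_ell2_def cinner_add_left)
  show "inner (r *\<^sub>R f) g = r * inner f g"
    by (simp add: inner_ell2_def scaleR_ell2_def cinner_scaleC_left)
  show "0 \<le> inner f f"
    by (simp add: inner_ell2_def cinner_self infsum_nonneg)
  show "inner f f = 0 \<longleftrightarrow> f = 0"
  proof
    assume "inner f f = 0"
    then have "(\<Sum>\<^sub>\<infinity>i. (cmod (coord f i))\<^sup>2) = 0"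
      by (simp add: inner_ell2_def cinner_self)
    then have "(cmod (coord f i))\<^sup>2 = 0" for i
      by (intro nonneg_infsum_le_0D[where A = UNIV and f = "\<lambda>i. (cmod (coord f i))\<^sup>2"])
        (auto simp: square_summable_coord)
    then show "f = 0"
      by (intro ell2_eqI) simp
  qed (simp add: inner_ell2_def cinner_def)
qed

end

lemma norm_ell2_squared: "(norm f)\<^sup>2 = (\<Sum>\<^sub>\<infinity>i. (cmod (coord f i))\<^sup>2)" for f :: "'i ell2"
  by (simp add: norm_ell2_def inner_ell2_def cinner_self infsum_nonneg)

lemma cinner_self_norm: "cinner f f = of_real ((norm f)\<^sup>2)"
  unfolding norm_ell2_squared by (rule cinner_self)

lemma cinner_add_right: "cinner f (g + h) = cinner f g + cinner f h"
  by (metis cinner_add_left cinner_commute complex_cnj_add)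

lemma cinner_scaleC_right: "cinner f (c *\<^sub>C g) = cnj c * cinner f g"
  by (metis cinner_scaleC_left cinner_commute complex_cnj_mult)

definition unit_vec :: "'i \<Rightarrow> 'i ell2"
  where "unit_vec k = Abs_ell2 (\<lambda>i. if i = k then 1 else 0)"

lemma coord_unit_vec [simp]: "coord (unit_vec k) i = (if i = k then 1 else 0)"
proof -
  have "(\<lambda>i. (cmod (if i = k then 1 else 0))\<^sup>2) summable_on UNIV"
    by (rule finite_nonzero_values_imp_summable_on) (rule finite_subset[of _ "{k}"], auto)
  from coord_Abs_ell2[OF this] show ?thesis
    by (simp add: unit_vec_def)
qed


section \<open>Operators\<close>

definition bounded_clinear :: "('i ell2 \<Rightarrow> 'j ell2) \<Rightarrow> bool"
  where "bounded_clinear T \<longleftrightarrow> bounded_linear T \<and> (\<forall>c f. T (c *\<^sub>C f) = c *\<^sub>C T f)"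

text \<open>
  The complex analogue of the library's \<open>adjoint\<close>; a bounded operator has exactly one adjoint.
\<close>

definition cadjoint :: "('i ell2 \<Rightarrow> 'j ell2) \<Rightarrow> 'j ell2 \<Rightarrow> 'i ell2"
  where "cadjoint T = (SOME S. \<forall>f g. cinner (T f) g = cinner f (S g))"

lemma cinner_right_eqI:
  assumes "\<And>f. cinner f g = cinner f h"
  shows "g = h"
proof -
  have "cinner (g - h) (g - h) = cinner (g - h) g + cinner (g - h) ((- 1) *\<^sub>C h)"
    unfolding cinner_add_right[symmetric] minus_ell2_def uminus_ell2_def by (rule refl)
  also have "\<dots> = 0"
    using assms[of "g - h"] by (simp add: cinner_scaleC_right)
  finally show ?thesis
    by (simp add: cinner_self_norm)
qed

lemma cadjoint_unique:
  assumes "\<And>f g. cinner (T f) g = cinner f (S g)"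
  shows "cadjoint T = S"
  unfolding cadjoint_def
  by (rule some_equality) (auto simp: assms intro!: ext cinner_right_eqI)

definition commutator :: "('i ell2 \<Rightarrow> 'i ell2) \<Rightarrow> ('i ell2 \<Rightarrow> 'i ell2) \<Rightarrow> 'i ell2 \<Rightarrow> 'i ell2"
  where "commutator S T f = S (T f) - T (S f)"

definition normal_operator :: "('i ell2 \<Rightarrow> 'i ell2) \<Rightarrow> bool"
  where "normal_operator N \<longleftrightarrow> bounded_clinear N \<and> cadjoint N \<circ> N = N \<circ> cadjoint N"

definition clinear_isometry :: "('i ell2 \<Rightarrow> 'j ell2) \<Rightarrow> bool"
  where "clinear_isometry V \<longleftrightarrow> bounded_clinear V \<and> (\<forall>f. norm (V f) = norm f)"

text \<open>
  The ambient Hilbert space of the normal operator \<open>N\<close> is taken to be a copy of \<open>\<ell>\<^sup>2(\<nat>)\<close>, in which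
  the space of \<open>T\<close> sits as the range of the isometry \<open>V\<close>; the equation \<open>N \<circ> V = V \<circ> T\<close> says that
  this range is invariant under \<open>N\<close> and that \<open>N\<close> restricts to \<open>T\<close> on it.  No extension is lost:
  inside an arbitrary ambient space, the closed linear span of the vectors \<open>N\<^sup>m (N\<^sup>*)\<^sup>n f\<close>, \<open>f\<close> in
  the space of \<open>T\<close>, reduces \<open>N\<close>, and it is separable and infinite-dimensional.
\<close>

definition subnormal :: "(nat ell2 \<Rightarrow> nat ell2) \<Rightarrow> bool"
  where "subnormal T \<longleftrightarrow>
    (\<exists>(N :: nat ell2 \<Rightarrow> nat ell2) (V :: nat ell2 \<Rightarrow> nat ell2).
       normal_operator N \<and> clinear_isometry V \<and> N \<circ> V = V \<circ> T)"

definition operator_matrix ::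
    "('i ell2 \<Rightarrow> 'i ell2) \<Rightarrow> ('i ell2 \<Rightarrow> 'i ell2) \<Rightarrow> ('i ell2 \<Rightarrow> 'i ell2) \<Rightarrow> ('i ell2 \<Rightarrow> 'i ell2) \<Rightarrow>
     'i ell2 \<times> 'i ell2 \<Rightarrow> 'i ell2 \<times> 'i ell2"
  where "operator_matrix A B C D = (\<lambda>(f, g). (A f + B g, C f + D g))"

definition cinner_sum :: "'i ell2 \<times> 'i ell2 \<Rightarrow> 'i ell2 \<times> 'i ell2 \<Rightarrow> complex"
  where "cinner_sum x y = cinner (fst x) (fst y) + cinner (snd x) (snd y)"

definition positive_on_sum :: "('i ell2 \<times> 'i ell2 \<Rightarrow> 'i ell2 \<times> 'i ell2) \<Rightarrow> bool"
  where "positive_on_sum M \<longleftrightarrow> (\<forall>x. cinner_sum (M x) x \<in> \<real>\<^sub>\<ge>\<^sub>0)"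

definition jointly_hyponormal :: "('i ell2 \<Rightarrow> 'i ell2) \<Rightarrow> ('i ell2 \<Rightarrow> 'i ell2) \<Rightarrow> bool"
  where "jointly_hyponormal T1 T2 \<longleftrightarrow>
    bounded_clinear T1 \<and> bounded_clinear T2 \<and> T1 \<circ> T2 = T2 \<circ> T1 \<and>
    positive_on_sum (operator_matrix
      (commutator (cadjoint T1) T1) (commutator (cadjoint T2) T1)
      (commutator (cadjoint T1) T2) (commutator (cadjoint T2) T2))"


section \<open>Weighted shifts\<close>

definition weight_family :: "('i \<Rightarrow> real) \<Rightarrow> bool"
  where "weight_family w \<longleftrightarrow> (\<forall>k. 0 < w k) \<and> bdd_above (range w)"

text \<open>
  For injective \<open>\<sigma>\<close> and bounded \<open>w\<close>, this is the bounded operator \<open>e\<^sub>k \<mapsto> w\<^sub>k e\<^bsub>\<sigma> k\<^esub>\<close>.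
\<close>

definition shift_along :: "('i \<Rightarrow> 'i) \<Rightarrow> ('i \<Rightarrow> real) \<Rightarrow> 'i ell2 \<Rightarrow> 'i ell2"
  where "shift_along \<sigma> w f =
    Abs_ell2 (\<lambda>i. if i \<in> range \<sigma> then of_real (w (inv \<sigma> i)) * coord f (inv \<sigma> i) else 0)"

definition wshift :: "(nat \<Rightarrow> real) \<Rightarrow> nat ell2 \<Rightarrow> nat ell2"
  where "wshift w = shift_along Suc w"

definition shift1 :: "(nat \<times> nat \<Rightarrow> real) \<Rightarrow> (nat \<times> nat) ell2 \<Rightarrow> (nat \<times> nat) ell2"
  where "shift1 \<alpha> = shift_along (\<lambda>(k1, k2). (Suc k1, k2)) \<alpha>"

definition shift2 :: "(nat \<times> nat \<Rightarrow> real) \<Rightarrow> (nat \<times> nat) ell2 \<Rightarrow> (nat \<times> nat) ell2"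
  where "shift2 \<beta> = shift_along (\<lambda>(k1, k2). (k1, Suc k2)) \<beta>"

definition commuting_weights :: "(nat \<times> nat \<Rightarrow> real) \<Rightarrow> (nat \<times> nat \<Rightarrow> real) \<Rightarrow> bool"
  where "commuting_weights \<alpha> \<beta> \<longleftrightarrow>
    (\<forall>k1 k2. \<beta> (Suc k1, k2) * \<alpha> (k1, k2) = \<alpha> (k1, Suc k2) * \<beta> (k1, k2))"

definition bergman_like_weights :: "real \<Rightarrow> nat \<Rightarrow> real"
  where "bergman_like_weights l k = sqrt (l - 1 / (real k + 2))"

definition S_weights :: "real \<Rightarrow> nat \<Rightarrow> real"
  where "S_weights a k = (if k = 0 then a else 1)"

lemma square_summable_shift_along:
  assumes "inj \<sigma>" "weight_family w"
  shows "(\<lambda>i. (cmod (if i \<in> range \<sigma> then of_real (w (inv \<sigma> i)) * coord f (inv \<sigma> i) else 0))\<^sup>2)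
           summable_on UNIV" (is "?F summable_on _")
    and "(\<Sum>\<^sub>\<infinity>i. (cmod (if i \<in> range \<sigma> then of_real (w (inv \<sigma> i)) * coord f (inv \<sigma> i) else 0))\<^sup>2)
           = (\<Sum>\<^sub>\<infinity>i. (w i)\<^sup>2 * (cmod (coord f i))\<^sup>2)"
    and "(\<lambda>i. (w i)\<^sup>2 * (cmod (coord f i))\<^sup>2) summable_on UNIV"
proof -
  obtain B where B: "\<And>k. 0 < w k" "\<And>k. w k \<le> B"
    using assms(2) by (auto simp: weight_family_def bdd_above_def)
  show s: "(\<lambda>i. (w i)\<^sup>2 * (cmod (coord f i))\<^sup>2) summable_on UNIV"
  proof (rule summable_on_comparison_test)
    show "(\<lambda>i. B\<^sup>2 * (cmod (coord f i))\<^sup>2) summable_on UNIV"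
      by (intro summable_on_cmult_right square_summable_coord)
    show "(w i)\<^sup>2 * (cmod (coord f i))\<^sup>2 \<le> B\<^sup>2 * (cmod (coord f i))\<^sup>2" for i
      using B[of i] by (intro mult_right_mono power_mono) auto
  qed auto
  have eq: "?F \<circ> \<sigma> = (\<lambda>i. (w i)\<^sup>2 * (cmod (coord f i))\<^sup>2)"
    by (auto simp: fun_eq_iff assms(1) norm_mult power_mult_distrib)
  have "?F summable_on range \<sigma> \<longleftrightarrow> (?F \<circ> \<sigma>) summable_on UNIV"
    by (rule summable_on_reindex) (rule assms(1))
  then have "?F summable_on range \<sigma>"
    using s eq by simp
  then show "?F summable_on UNIV"
    by (subst summable_on_cong_neutral[where g = ?F and T = "range \<sigma>"]) auto
  have "infsum ?F UNIV = infsum ?F (range \<sigma>)"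
    by (rule infsum_cong_neutral) auto
  also have "\<dots> = infsum (?F \<circ> \<sigma>) UNIV"
    by (rule infsum_reindex) (rule assms(1))
  finally show "infsum ?F UNIV = (\<Sum>\<^sub>\<infinity>i. (w i)\<^sup>2 * (cmod (coord f i))\<^sup>2)"
    by (simp add: eq)
qed

lemma coord_shift_along:
  assumes "inj \<sigma>" "weight_family w"
  shows "coord (shift_along \<sigma> w f) i =
    (if i \<in> range \<sigma> then of_real (w (inv \<sigma> i)) * coord f (inv \<sigma> i) else 0)"
  unfolding shift_along_def
  by (subst coord_Abs_ell2[OF square_summable_shift_along(1)[OF assms]]) simp

lemma bounded_clinear_shift_along:
  assumes "inj \<sigma>" "weight_family w"
  shows "bounded_clinear (shift_along \<sigma> w)"
proof -
  obtain B where B: "\<And>k. 0 < w k" "\<And>k. w k \<le> B"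
    using assms(2) by (auto simp: weight_family_def bdd_above_def)
  have B0: "0 \<le> B"
    using B[of undefined] by simp
  have "norm (shift_along \<sigma> w f) \<le> norm f * B" for f
  proof -
    have "(norm (shift_along \<sigma> w f))\<^sup>2 = (\<Sum>\<^sub>\<infinity>i. (w i)\<^sup>2 * (cmod (coord f i))\<^sup>2)"
      unfolding norm_ell2_squared coord_shift_along[OF assms]
      by (rule square_summable_shift_along(2)[OF assms])
    also have "\<dots> \<le> (\<Sum>\<^sub>\<infinity>i. B\<^sup>2 * (cmod (coord f i))\<^sup>2)"
    proof (rule infsum_mono)
      show "(w i)\<^sup>2 * (cmod (coord f i))\<^sup>2 \<le> B\<^sup>2 * (cmod (coord f i))\<^sup>2" for i
        using B[of i] by (intro mult_right_mono power_mono) auto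
    qed (auto intro!: summable_on_cmult_right square_summable_coord
          square_summable_shift_along(3)[OF assms])
    also have "\<dots> = (norm f * B)\<^sup>2"
      unfolding infsum_cmult_right' power_mult_distrib norm_ell2_squared by (rule mult.commute)
    finally show ?thesis
      by (rule power2_le_imp_le) (simp add: B0)
  qed
  then have "bounded_linear (shift_along \<sigma> w)"
    by (intro bounded_linear_intro[where K = B])
      (auto intro!: ell2_eqI simp: coord_shift_along[OF assms] algebra_simps)
  then show ?thesis
    by (auto simp: bounded_clinear_def coord_shift_along[OF assms] intro!: ell2_eqI)
qed

lemma shift_along_unit_vec:
  assumes "inj \<sigma>" "weight_family w"
  shows "shift_along \<sigma> w (unit_vec k) = of_real (w k) *\<^sub>C unit_vec (\<sigma> k)"
  by (rule ell2_eqI) (auto simp: coord_shift_along[OF assms] inv_f_f[OF assms(1)])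

lemma wshift_unit_vec:
  "weight_family w \<Longrightarrow> wshift w (unit_vec k) = of_real (w k) *\<^sub>C unit_vec (Suc k)"
  unfolding wshift_def by (rule shift_along_unit_vec) auto

lemma inj_steps:
  "inj (\<lambda>(k1 :: nat, k2 :: nat). (Suc k1, k2))" "inj (\<lambda>(k1 :: nat, k2 :: nat). (k1, Suc k2))"
  by (auto simp: inj_def)

lemma bounded_clinear_shift1: "weight_family \<alpha> \<Longrightarrow> bounded_clinear (shift1 \<alpha>)"
  unfolding shift1_def by (rule bounded_clinear_shift_along[OF inj_steps(1)])

lemma bounded_clinear_shift2: "weight_family \<beta> \<Longrightarrow> bounded_clinear (shift2 \<beta>)"
  unfolding shift2_def by (rule bounded_clinear_shift_along[OF inj_steps(2)])

lemma shift1_unit_vec: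
  "weight_family \<alpha> \<Longrightarrow>
    shift1 \<alpha> (unit_vec (k1, k2)) = of_real (\<alpha> (k1, k2)) *\<^sub>C unit_vec (Suc k1, k2)"
  unfolding shift1_def using shift_along_unit_vec[OF inj_steps(1), of \<alpha> "(k1, k2)"] by simp

lemma shift2_unit_vec:
  "weight_family \<beta> \<Longrightarrow>
    shift2 \<beta> (unit_vec (k1, k2)) = of_real (\<beta> (k1, k2)) *\<^sub>C unit_vec (k1, Suc k2)"
  unfolding shift2_def using shift_along_unit_vec[OF inj_steps(2), of \<beta> "(k1, k2)"] by simp

lemma coord_shift1:
  assumes "weight_family \<alpha>"
  shows "coord (shift1 \<alpha> f) (k1, k2) =
    (case k1 of 0 \<Rightarrow> 0 | Suc m \<Rightarrow> of_real (\<alpha> (m, k2)) * coord f (m, k2))"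
proof -
  let ?s = "\<lambda>(k1 :: nat, k2 :: nat). (Suc k1, k2)"
  have "inv ?s (Suc m, k2) = (m, k2)" for m
    using inv_f_f[OF inj_steps(1), of "(m, k2)"] by simp
  then show ?thesis
    by (auto simp: shift1_def coord_shift_along[OF inj_steps(1) assms] image_iff split: nat.splits)
qed

lemma coord_shift2:
  assumes "weight_family \<beta>"
  shows "coord (shift2 \<beta> f) (k1, k2) =
    (case k2 of 0 \<Rightarrow> 0 | Suc m \<Rightarrow> of_real (\<beta> (k1, m)) * coord f (k1, m))"
proof -
  let ?s = "\<lambda>(k1 :: nat, k2 :: nat). (k1, Suc k2)"
  have "inv ?s (k1, Suc m) = (k1, m)" for m
    using inv_f_f[OF inj_steps(2), of "(k1, m)"] by simp
  then show ?thesis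
    by (auto simp: shift2_def coord_shift_along[OF inj_steps(2) assms] image_iff split: nat.splits)
qed

lemma commuting_shifts_iff:
  assumes "weight_family \<alpha>" "weight_family \<beta>"
  shows "shift1 \<alpha> \<circ> shift2 \<beta> = shift2 \<beta> \<circ> shift1 \<alpha> \<longleftrightarrow> commuting_weights \<alpha> \<beta>"
proof
  assume eq: "shift1 \<alpha> \<circ> shift2 \<beta> = shift2 \<beta> \<circ> shift1 \<alpha>"
  have "\<beta> (Suc k1, k2) * \<alpha> (k1, k2) = \<alpha> (k1, Suc k2) * \<beta> (k1, k2)" for k1 k2
  proof -
    have "coord ((shift1 \<alpha> \<circ> shift2 \<beta>) (unit_vec (k1, k2))) (Suc k1, Suc k2)
        = coord ((shift2 \<beta> \<circ> shift1 \<alpha>) (unit_vec (k1, k2))) (Suc k1, Suc k2)"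
      by (simp only: eq)
    then have "complex_of_real (\<alpha> (k1, Suc k2) * \<beta> (k1, k2))
        = complex_of_real (\<beta> (Suc k1, k2) * \<alpha> (k1, k2))"
      by (simp add: coord_shift1[OF assms(1)] coord_shift2[OF assms(2)])
    then show ?thesis
      by (simp only: of_real_eq_iff)
  qed
  then show "commuting_weights \<alpha> \<beta>"
    by (simp add: commuting_weights_def)
next
  assume c: "commuting_weights \<alpha> \<beta>"
  have r: "complex_of_real (\<alpha> (m, Suc n)) * (complex_of_real (\<beta> (m, n)) * z)
      = complex_of_real (\<beta> (Suc m, n)) * (complex_of_real (\<alpha> (m, n)) * z)" for m n z
    using c by (metis commuting_weights_def mult.assoc of_real_mult)
  show "shift1 \<alpha> \<circ> shift2 \<beta> = shift2 \<beta> \<circ> shift1 \<alpha>"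
  proof (rule ext, rule ell2_eqI)
    fix f and i :: "nat \<times> nat"
    show "coord ((shift1 \<alpha> \<circ> shift2 \<beta>) f) i = coord ((shift2 \<beta> \<circ> shift1 \<alpha>) f) i"
      by (cases i)
        (auto simp: coord_shift1[OF assms(1)] coord_shift2[OF assms(2)] r split: nat.splits)
  qed
qed

end

theory Submission
  imports Defs
begin

text \<open>
  Write \<open>x j k\<close> for the square of the weight of row \<open>j\<close> at position \<open>k\<close>. Commutativity forces the
  squares of the vertical weights to be \<open>W j ^ 2 * P j k\<close>, where
  \<open>P j k = (\<Prod>i<k. x (j + 1) i / x j i)\<close>. By the six-point test (lemma \<open>six_point_test\<close>) the pair is
  jointly hyponormal if, at each lattice point, a real \<open>2 \<times> 2\<close> matrix is positive semidefinite.
  Its determinant condition reads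
  \<open>W j ^ 2 * P j k * (x (j + 1) k - x j k)^2 / x j k
     \<le> (x j (k + 1) - x j k) * (W (j + 1) ^ 2 * P (j + 1) k - W j ^ 2 * P j k)\<close>.

  From level \<open>k2\<close> on, neighbouring rows coincide, so the left-hand side vanishes and \<open>P = 1\<close>: a
  nondecreasing \<open>W\<close> suffices. Below that level the increment \<open>x j (k + 1) - x j k\<close> of a Bergman-like
  row is \<open>1 / ((k + 2) * (k + 3))\<close>, which decays, and \<open>P j k\<close> decays as well. The condition for all
  \<open>k\<close> then calls for \<open>P (j + 1) k / P j k\<close> to outgrow a quadratic polynomial in \<open>k\<close>. This holds when
  the levels \<open>l j\<close> are log-convex in \<open>j\<close> with a definite margin, up to and including the rows
  \<open>S_a\<close>, which count as level \<open>1\<close>. The choice \<open>l j = 4 ^ ((k2 - j)^2)\<close> has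
  \<open>l j * l (j + 2) = 16 * (l (j + 1))^2\<close>, and the margin \<open>16\<close> absorbs the corrections
  \<open>1 / (k + 2)\<close>: lemma \<open>row_quot_growth\<close> gives \<open>P (j + 1) k / P j k \<ge> a^2 * 2^k\<close>.
  What is left is a single constant \<open>Q\<close>, depending on \<open>k2\<close> and \<open>a\<close> only, such that
  \<open>W (j + 1) ^ 2 \<ge> Q * W j ^ 2\<close> for \<open>j < k2\<close> suffices (lemma \<open>column_weight_gap\<close>).

  A subnormal shift with strictly increasing weights and such a steep start comes from a Berger measure with
  finitely many atoms \<open>q ^ (2 * i)\<close> of masses \<open>q ^ - (i^2)\<close>: its \<open>n\<close>-th moment is comparable to
  \<open>q ^ (n^2)\<close>, so the quotient of consecutive squared weights is of order \<open>q ^ 2\<close>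
  (lemma \<open>subnormal_shift_with_steep_start\<close>).
\<close>


section \<open>The six-point test for commuting shifts\<close>

lemma cadjoint_shift_along:
  assumes "inj \<sigma>" "weight_family w"
  shows "cinner (shift_along \<sigma> w f) g = cinner f (cadjoint (shift_along \<sigma> w) g)"
    and "coord (cadjoint (shift_along \<sigma> w) g) i = of_real (w i) * coord g (\<sigma> i)"
proof -
  define S where "S g = Abs_ell2 (\<lambda>i. of_real (w i) * coord g (\<sigma> i))" for g
  obtain B where B: "\<And>k. 0 < w k" "\<And>k. w k \<le> B"
    using assms(2) by (auto simp: weight_family_def bdd_above_def)
  have S: "coord (S g) i = of_real (w i) * coord g (\<sigma> i)" for g i
    unfolding S_def
  proof (subst coord_Abs_ell2)
    have "(\<lambda>i. (cmod (coord g i))\<^sup>2) summable_on range \<sigma>"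
      by (rule summable_on_subset_banach[OF square_summable_coord]) simp
    then have *: "(\<lambda>i. (cmod (coord g (\<sigma> i)))\<^sup>2) summable_on UNIV"
      using summable_on_reindex[OF assms(1), of "\<lambda>i. (cmod (coord g i))\<^sup>2"] by (simp add: o_def)
    show "(\<lambda>i. (cmod (of_real (w i) * coord g (\<sigma> i)))\<^sup>2) summable_on UNIV"
    proof (rule summable_on_comparison_test)
      show "(\<lambda>i. B\<^sup>2 * (cmod (coord g (\<sigma> i)))\<^sup>2) summable_on UNIV"
        by (intro summable_on_cmult_right *)
      show "(cmod (of_real (w i) * coord g (\<sigma> i)))\<^sup>2 \<le> B\<^sup>2 * (cmod (coord g (\<sigma> i)))\<^sup>2" for i
        using B[of i] by (auto simp: norm_mult power_mult_distrib intro!: mult_right_mono power_mono)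
    qed auto
  qed simp
  have adj: "cinner (shift_along \<sigma> w f) g = cinner f (S g)" for f g
  proof -
    have "cinner (shift_along \<sigma> w f) g
        = (\<Sum>\<^sub>\<infinity>i\<in>range \<sigma>. coord (shift_along \<sigma> w f) i * cnj (coord g i))"
      unfolding cinner_def by (rule infsum_cong_neutral) (auto simp: coord_shift_along[OF assms])
    also have "\<dots> = cinner f (S g)"
      unfolding cinner_def
      by (subst infsum_reindex[OF assms(1)])
        (auto intro!: infsum_cong simp: coord_shift_along[OF assms] S inv_f_f[OF assms(1)])
    finally show ?thesis .
  qed
  have "cadjoint (shift_along \<sigma> w) = S"
    by (rule cadjoint_unique) (rule adj)
  then show "cinner (shift_along \<sigma> w f) g = cinner f (cadjoint (shift_along \<sigma> w) g)"
    and "coord (cadjoint (shift_along \<sigma> w) g) i = of_real (w i) * coord g (\<sigma> i)"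
    by (simp_all add: adj S)
qed

lemma weighted_quadratic_nonneg:
  fixes a b c :: real and z u :: complex
  assumes "0 \<le> a" "0 \<le> b" "c\<^sup>2 \<le> a * b"
  shows "0 \<le> a * (cmod z)\<^sup>2 + 2 * Re (of_real c * (u * cnj z)) + b * (cmod u)\<^sup>2"
proof -
  have "\<bar>c\<bar> \<le> sqrt a * sqrt b"
    using real_sqrt_le_mono[OF assms(3)] by (simp add: real_sqrt_mult)
  then have "\<bar>c\<bar> * (cmod u * cmod z) \<le> sqrt a * sqrt b * (cmod u * cmod z)"
    by (intro mult_right_mono) auto
  moreover have "\<bar>Re (of_real c * (u * cnj z))\<bar> \<le> \<bar>c\<bar> * (cmod u * cmod z)"
    using abs_Re_le_cmod[of "of_real c * (u * cnj z)"] by (simp add: norm_mult)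
  moreover have "0 \<le> (sqrt a * cmod z - sqrt b * cmod u)\<^sup>2" by simp
  ultimately show ?thesis
    using assms(1,2) by (simp add: power2_diff power_mult_distrib algebra_simps)
qed

text \<open>
  Let \<open>T\<close> and \<open>U\<close> be the shifts along \<open>\<sigma>\<close> and \<open>\<tau>\<close>. Moving adjoints across the inner product
  turns the quadratic form of the commutator matrix at \<open>(f, g)\<close> into
  \<open>\<parallel>T f\<parallel>^2 - \<parallel>T* f\<parallel>^2 + \<parallel>U g\<parallel>^2 - \<parallel>U* g\<parallel>^2 + 2 Re (\<langle>T g, U f\<rangle> - \<langle>U* g, T* f\<rangle>)\<close>.
  In coordinates, each cross term couples \<open>f\<close> at \<open>\<sigma> p\<close> only with \<open>g\<close> at \<open>\<tau> p\<close>. So the form splits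
  into one \<open>2 \<times> 2\<close> form for each lattice point \<open>p\<close>, plus nonnegative contributions of the
  coordinates of \<open>f\<close> outside \<open>range \<sigma>\<close> and of \<open>g\<close> outside \<open>range \<tau>\<close>. For \<open>T g\<close> and \<open>U f\<close> to
  overlap only at points \<open>\<sigma> (\<tau> p)\<close>, the two ranges must meet in \<open>range (\<sigma> \<circ> \<tau>)\<close>.
\<close>

lemma six_point_test:
  fixes \<sigma> \<tau> :: "'i \<Rightarrow> 'i"
  assumes inj: "inj \<sigma>" "inj \<tau>" and w: "weight_family \<alpha>" "weight_family \<beta>"
    and comm: "shift_along \<sigma> \<alpha> \<circ> shift_along \<tau> \<beta> = shift_along \<tau> \<beta> \<circ> shift_along \<sigma> \<alpha>"
    and st: "\<And>p. \<sigma> (\<tau> p) = \<tau> (\<sigma> p)" and ran: "range \<sigma> \<inter> range \<tau> \<subseteq> range (\<sigma> \<circ> \<tau>)"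
    and diag: "\<And>p. (\<alpha> p)\<^sup>2 \<le> (\<alpha> (\<sigma> p))\<^sup>2" "\<And>p. (\<beta> p)\<^sup>2 \<le> (\<beta> (\<tau> p))\<^sup>2"
    and det: "\<And>p. (\<alpha> (\<tau> p) * \<beta> (\<sigma> p) - \<alpha> p * \<beta> p)\<^sup>2
        \<le> ((\<alpha> (\<sigma> p))\<^sup>2 - (\<alpha> p)\<^sup>2) * ((\<beta> (\<tau> p))\<^sup>2 - (\<beta> p)\<^sup>2)"
  shows "jointly_hyponormal (shift_along \<sigma> \<alpha>) (shift_along \<tau> \<beta>)"
proof -
  let ?T = "shift_along \<sigma> \<alpha>" and ?U = "shift_along \<tau> \<beta>"
  let ?T' = "cadjoint ?T" and ?U' = "cadjoint ?U"
  note cT = coord_shift_along[OF inj(1) w(1)] and cU = coord_shift_along[OF inj(2) w(2)]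
  note aT = cadjoint_shift_along[OF inj(1) w(1)] and aU = cadjoint_shift_along[OF inj(2) w(2)]
  have norm_shift: "(norm (shift_along \<rho> v f))\<^sup>2 \<ge> (\<Sum>\<^sub>\<infinity>p. (v (\<rho> p))\<^sup>2 * (cmod (coord f (\<rho> p)))\<^sup>2)"
      "(\<lambda>p. (v (\<rho> p))\<^sup>2 * (cmod (coord f (\<rho> p)))\<^sup>2) summable_on UNIV"
    if "inj \<rho>" "weight_family v" for \<rho> :: "'i \<Rightarrow> 'i" and v f
  proof -
    let ?F = "\<lambda>i. (v i)\<^sup>2 * (cmod (coord f i))\<^sup>2"
    have s: "?F summable_on UNIV"
      by (rule square_summable_shift_along(3)[OF that])
    then have s': "?F summable_on range \<rho>"
      by (rule summable_on_subset_banach) simp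
    then show "(\<lambda>p. (v (\<rho> p))\<^sup>2 * (cmod (coord f (\<rho> p)))\<^sup>2) summable_on UNIV"
      using summable_on_reindex[OF that(1), of ?F] by (simp add: o_def)
    have "(\<Sum>\<^sub>\<infinity>p. (v (\<rho> p))\<^sup>2 * (cmod (coord f (\<rho> p)))\<^sup>2) = infsum ?F (range \<rho>)"
      by (subst infsum_reindex[OF that(1)]) (simp add: o_def)
    also have "\<dots> \<le> infsum ?F UNIV"
      by (rule infsum_mono_neutral[OF s' s]) auto
    also have "\<dots> = (norm (shift_along \<rho> v f))\<^sup>2"
      unfolding norm_ell2_squared coord_shift_along[OF that]
      by (rule square_summable_shift_along(2)[OF that, symmetric])
    finally show "(norm (shift_along \<rho> v f))\<^sup>2 \<ge> (\<Sum>\<^sub>\<infinity>p. (v (\<rho> p))\<^sup>2 * (cmod (coord f (\<rho> p)))\<^sup>2)" .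
  qed
  have norm_adj: "((\<lambda>p. (v p)\<^sup>2 * (cmod (coord f (\<rho> p)))\<^sup>2) has_sum (norm (cadjoint (shift_along \<rho> v) f))\<^sup>2) UNIV"
    if "inj \<rho>" "weight_family v" for \<rho> :: "'i \<Rightarrow> 'i" and v f
    using has_sum_infsum[OF square_summable_coord[of "cadjoint (shift_along \<rho> v) f"]]
    by (simp add: norm_ell2_squared cadjoint_shift_along(2)[OF that] norm_mult power_mult_distrib)
  have cross: "((\<lambda>p. of_real (\<alpha> (\<tau> p) * \<beta> (\<sigma> p)) * (coord g (\<tau> p) * cnj (coord f (\<sigma> p))))
      has_sum cinner (?T g) (?U f)) UNIV" for f g
  proof -
    let ?F = "\<lambda>i. coord (?T g) i * cnj (coord (?U f) i)"
    have "(?F has_sum cinner (?T g) (?U f)) UNIV"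
      unfolding cinner_def by (rule has_sum_infsum[OF summable_coord_mult])
    then have "(?F has_sum cinner (?T g) (?U f)) (range (\<sigma> \<circ> \<tau>))"
    proof (rule has_sum_cong_neutral[THEN iffD1, rotated -1])
      fix i assume "i \<in> UNIV - range (\<sigma> \<circ> \<tau>)"
      then have "i \<notin> range \<sigma> \<or> i \<notin> range \<tau>" using ran by blast
      then show "?F i = 0" by (auto simp: cT cU)
    qed auto
    then have "((?F \<circ> (\<sigma> \<circ> \<tau>)) has_sum cinner (?T g) (?U f)) UNIV"
      using has_sum_reindex[OF inj_compose[OF inj]] by blast
    moreover have "?F ((\<sigma> \<circ> \<tau>) p) = of_real (\<alpha> (\<tau> p) * \<beta> (\<sigma> p)) * (coord g (\<tau> p) * cnj (coord f (\<sigma> p)))" for p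
      by (simp add: cT cU inv_f_f[OF inj(1)]) (simp add: st inv_f_f[OF inj(2)])
    ultimately show ?thesis by (simp add: o_def)
  qed
  have cross': "((\<lambda>p. of_real (\<alpha> p * \<beta> p) * (coord g (\<tau> p) * cnj (coord f (\<sigma> p))))
      has_sum cinner (?U' g) (?T' f)) UNIV" for f g
    using has_sum_infsum[OF summable_coord_mult[of "?U' g" "?T' f"]]
    by (simp add: cinner_def aT(2) aU(2) mult_ac)
  have "cinner_sum (operator_matrix (commutator ?T' ?T) (commutator ?U' ?T)
          (commutator ?T' ?U) (commutator ?U' ?U) (f, g)) (f, g) \<in> \<real>\<^sub>\<ge>\<^sub>0" for f g
  proof -
    have diff: "cinner (x - y) z = cinner x z - cinner y z" for x y z :: "'i ell2"
      using cinner_add_left[of "x - y" y z] by simp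
    have adj_flip: "cinner (?T' x) y = cinner x (?T y)" "cinner (?U' x) y = cinner x (?U y)" for x y
      by (metis aT(1) cinner_commute, metis aU(1) cinner_commute)
    have adj_first: "cinner (?T' (?T f)) f = of_real ((norm (?T f))\<^sup>2)"
        "cinner (?U' (?T g)) f = cinner (?T g) (?U f)"
        "cinner (?T' (?U f)) g = cnj (cinner (?T g) (?U f))"
        "cinner (?U' (?U g)) g = of_real ((norm (?U g))\<^sup>2)"
      by (simp_all only: adj_flip cinner_self_norm flip: cinner_commute)
    have adj_last: "cinner (?T (?T' f)) f = of_real ((norm (?T' f))\<^sup>2)"
        "cinner (?T (?U' g)) f = cinner (?U' g) (?T' f)"
        "cinner (?U (?T' f)) g = cnj (cinner (?U' g) (?T' f))"
        "cinner (?U (?U' g)) g = of_real ((norm (?U' g))\<^sup>2)"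
      by (simp_all only: aT(1) aU(1) cinner_self_norm flip: cinner_commute)
    let ?X = "cinner (?T g) (?U f) - cinner (?U' g) (?T' f)"
    define R where "R = (norm (?T f))\<^sup>2 - (norm (?T' f))\<^sup>2 + ((norm (?U g))\<^sup>2 - (norm (?U' g))\<^sup>2) + 2 * Re ?X"
    have "cinner_sum (operator_matrix (commutator ?T' ?T) (commutator ?U' ?T)
          (commutator ?T' ?U) (commutator ?U' ?U) (f, g)) (f, g)
      = of_real ((norm (?T f))\<^sup>2 - (norm (?T' f))\<^sup>2 + ((norm (?U g))\<^sup>2 - (norm (?U' g))\<^sup>2)) + (?X + cnj ?X)"
      by (simp add: cinner_sum_def operator_matrix_def commutator_def cinner_add_left diff adj_first adj_last)
    also have "\<dots> = of_real R"
      by (simp only: R_def complex_add_cnj of_real_add)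
    finally have eq: "cinner_sum (operator_matrix (commutator ?T' ?T) (commutator ?U' ?T)
          (commutator ?T' ?U) (commutator ?U' ?U) (f, g)) (f, g) = of_real R" .
    \<comment> \<open>The contribution of the lattice point \<open>p\<close>; the sum over all \<open>p\<close> omits the boundary terms.\<close>
    let ?q = "\<lambda>p. ((\<alpha> (\<sigma> p))\<^sup>2 * (cmod (coord f (\<sigma> p)))\<^sup>2 - (\<alpha> p)\<^sup>2 * (cmod (coord f (\<sigma> p)))\<^sup>2)
       + ((\<beta> (\<tau> p))\<^sup>2 * (cmod (coord g (\<tau> p)))\<^sup>2 - (\<beta> p)\<^sup>2 * (cmod (coord g (\<tau> p)))\<^sup>2)
       + 2 * (Re (of_real (\<alpha> (\<tau> p) * \<beta> (\<sigma> p)) * (coord g (\<tau> p) * cnj (coord f (\<sigma> p))))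
           - Re (of_real (\<alpha> p * \<beta> p) * (coord g (\<tau> p) * cnj (coord f (\<sigma> p)))))"
    let ?s = "\<lambda>\<rho> v h. (\<Sum>\<^sub>\<infinity>p. (v (\<rho> p))\<^sup>2 * (cmod (coord h (\<rho> p)))\<^sup>2)"
    have has_sum_minus: "((\<lambda>p. h p - h' p) has_sum (H - H')) UNIV"
      if "(h has_sum H) UNIV" "(h' has_sum H') UNIV"
      for h h' :: "'i \<Rightarrow> real" and H H'
      using has_sum_add[OF that(1) has_sum_uminusI[OF that(2)]] by simp
    have "(?q has_sum (?s \<sigma> \<alpha> f - (norm (?T' f))\<^sup>2 + (?s \<tau> \<beta> g - (norm (?U' g))\<^sup>2) + 2 * (Re (cinner (?T g) (?U f)) - Re (cinner (?U' g) (?T' f))))) UNIV"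
      by (intro has_sum_add has_sum_minus has_sum_cmult_right has_sum_Re norm_adj inj w cross cross'
          has_sum_infsum norm_shift(2))
    moreover have "0 \<le> ?q p" for p
    proof -
      have "?q p = ((\<alpha> (\<sigma> p))\<^sup>2 - (\<alpha> p)\<^sup>2) * (cmod (coord f (\<sigma> p)))\<^sup>2
        + 2 * Re (of_real (\<alpha> (\<tau> p) * \<beta> (\<sigma> p) - \<alpha> p * \<beta> p) * (coord g (\<tau> p) * cnj (coord f (\<sigma> p))))
        + ((\<beta> (\<tau> p))\<^sup>2 - (\<beta> p)\<^sup>2) * (cmod (coord g (\<tau> p)))\<^sup>2"
        by (simp add: algebra_simps)
      also have "\<dots> \<ge> 0"
        using diag[of p] by (intro weighted_quadratic_nonneg det) auto
      finally show ?thesis .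
    qed
    ultimately have "0 \<le> ?s \<sigma> \<alpha> f - (norm (?T' f))\<^sup>2 + (?s \<tau> \<beta> g - (norm (?U' g))\<^sup>2) + 2 * Re ?X"
      unfolding minus_complex.sel by (rule has_sum_nonneg)
    also have "\<dots> \<le> R"
      unfolding R_def using norm_shift(1)[OF inj(1) w(1), of f] norm_shift(1)[OF inj(2) w(2), of g] by simp
    finally show ?thesis
      unfolding eq by simp
  qed
  then show ?thesis
    unfolding jointly_hyponormal_def positive_on_sum_def
    using comm bounded_clinear_shift_along[OF inj(1) w(1)] bounded_clinear_shift_along[OF inj(2) w(2)]
    by auto
qed


section \<open>Subnormal shifts with finitely atomic Berger measure\<close>

lemma normal_operator_shift_along:
  assumes "bij \<sigma>" "weight_family w" and inv: "\<And>i. w (\<sigma> i) = w i"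
  shows "normal_operator (shift_along \<sigma> w)"
proof -
  have inj: "inj \<sigma>" and surj: "range \<sigma> = UNIV"
    using assms(1) by (auto simp: bij_def)
  have "w (inv \<sigma> i) = w i" for i
    using inv[of "inv \<sigma> i"] surj by (simp add: surj_f_inv_f)
  then have "cadjoint (shift_along \<sigma> w) (shift_along \<sigma> w f)
      = shift_along \<sigma> w (cadjoint (shift_along \<sigma> w) f)" for f
    using surj by (intro ell2_eqI)
      (simp add: coord_shift_along[OF inj assms(2)] cadjoint_shift_along(2)[OF inj assms(2)]
        inv inv_f_f[OF inj] surj_f_inv_f)
  then show ?thesis
    unfolding normal_operator_def using bounded_clinear_shift_along[OF inj assms(2)] by auto
qed

text \<open>
  The moments of the measure with mass \<open>\<rho> i\<close> at \<open>t i\<close>, \<open>i \<le> m\<close>. Up to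
  normalisation, it is the Berger measure of the shift with weights \<open>moment_weight m \<rho> t\<close>.
\<close>

definition atomic_moment :: "nat \<Rightarrow> (nat \<Rightarrow> real) \<Rightarrow> (nat \<Rightarrow> real) \<Rightarrow> nat \<Rightarrow> real"
  where "atomic_moment m \<rho> t n = (\<Sum>i\<le>m. \<rho> i * t i ^ n)"

definition moment_weight :: "nat \<Rightarrow> (nat \<Rightarrow> real) \<Rightarrow> (nat \<Rightarrow> real) \<Rightarrow> nat \<Rightarrow> real"
  where "moment_weight m \<rho> t n = sqrt (atomic_moment m \<rho> t (Suc n) / atomic_moment m \<rho> t n)"

lemma atomic_moment_pos:
  assumes "\<And>i. 0 < \<rho> i" "\<And>i. 0 < t i"
  shows "0 < atomic_moment m \<rho> t n"
  unfolding atomic_moment_def by (intro sum_pos) (auto simp: assms)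

lemma weight_family_moment_weight:
  assumes "\<And>i. 0 < \<rho> i" "\<And>i. 0 < t i"
  shows "weight_family (moment_weight m \<rho> t)"
proof -
  note pos = atomic_moment_pos[of \<rho> t, OF assms]
  have "moment_weight m \<rho> t n \<le> sqrt (\<Sum>i\<le>m. t i)" for n
  proof -
    have "atomic_moment m \<rho> t (Suc n) \<le> (\<Sum>i\<le>m. (\<Sum>i\<le>m. t i) * (\<rho> i * t i ^ n))"
      unfolding atomic_moment_def
    proof (rule sum_mono)
      fix i assume "i \<in> {..m}"
      then have "t i \<le> (\<Sum>i\<le>m. t i)"
        using assms(2) by (intro member_le_sum) (auto intro: less_imp_le)
      then have "t i * (\<rho> i * t i ^ n) \<le> (\<Sum>i\<le>m. t i) * (\<rho> i * t i ^ n)"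
        using assms by (intro mult_right_mono) (auto intro: less_imp_le)
      then show "\<rho> i * t i ^ Suc n \<le> (\<Sum>i\<le>m. t i) * (\<rho> i * t i ^ n)"
        by (simp add: mult_ac)
    qed
    also have "\<dots> = (\<Sum>i\<le>m. t i) * atomic_moment m \<rho> t n"
      by (simp add: atomic_moment_def sum_distrib_left)
    finally show ?thesis
      unfolding moment_weight_def using pos[of m n] by (simp add: divide_le_eq)
  qed
  then have "bdd_above (range (moment_weight m \<rho> t))"
    by (intro bdd_aboveI2)
  then show ?thesis
    using pos by (simp add: weight_family_def moment_weight_def)
qed

text \<open>
  The normal extension is a direct sum of multiples \<open>sqrt (t i) * U\<close> of the bilateral shift \<open>U\<close>,
  one for each atom. The basis vector \<open>e n\<close> goes to the unit vector with component
  \<open>sqrt (\<rho> i * t i ^ n / \<gamma> n)\<close> at place \<open>n\<close> of the \<open>i\<close>-th summand, \<open>\<gamma> n\<close> being the \<open>n\<close>-th moment.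
  To land in \<open>\<ell>\<^sup>2(\<nat>)\<close>, the index set \<open>\<nat> \<times> \<int>\<close> is enumerated by a bijection \<open>\<phi>\<close>; on the summands
  \<open>i > m\<close>, which the isometry avoids, the extension acts as \<open>U\<close>.
\<close>

lemma subnormal_moment_weight:
  assumes \<rho>: "\<And>i. 0 < \<rho> i" and t: "\<And>i. 0 < t i"
  shows "subnormal (wshift (moment_weight m \<rho> t))"
proof -
  let ?\<gamma> = "atomic_moment m \<rho> t" and ?W = "moment_weight m \<rho> t"
  note \<gamma>_pos = atomic_moment_pos[of \<rho> t, OF \<rho> t]
  note W = weight_family_moment_weight[of \<rho> t, OF \<rho> t]
  obtain \<phi> :: "nat \<times> int \<Rightarrow> nat" where \<phi>: "bij \<phi>"
    using to_nat_on_infinite[of "UNIV :: (nat \<times> int) set"] by (auto simp: finite_prod)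
  have inj\<phi>: "inj \<phi>" and surj\<phi>: "surj \<phi>"
    using \<phi> by (auto simp: bij_def)
  define \<psi> where "\<psi> = inv \<phi>"
  have \<psi>\<phi> [simp]: "\<psi> (\<phi> x) = x" and \<phi>\<psi> [simp]: "\<phi> (\<psi> k) = k" for x k
    unfolding \<psi>_def using \<phi> by (simp_all add: inv_f_f[OF inj\<phi>] surj_f_inv_f[OF surj\<phi>])
  define \<sigma> where "\<sigma> k = \<phi> (fst (\<psi> k), snd (\<psi> k) + 1)" for k
  define w where "w k = (if fst (\<psi> k) \<le> m then sqrt (t (fst (\<psi> k))) else 1)" for k
  define N where "N = shift_along \<sigma> w"
  have \<sigma>_pred: "\<sigma> (\<phi> (fst (\<psi> k), snd (\<psi> k) - 1)) = k" for k
    by (simp add: \<sigma>_def)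
  have inj\<sigma>: "inj \<sigma>"
    by (rule inj_on_inverseI[of _ "\<lambda>k. \<phi> (fst (\<psi> k), snd (\<psi> k) - 1)"]) (simp add: \<sigma>_def)
  have surj\<sigma>: "surj \<sigma>"
    by (rule surjI[of _ "\<lambda>k. \<phi> (fst (\<psi> k), snd (\<psi> k) - 1)"]) (rule \<sigma>_pred)
  have inv\<sigma>: "inv \<sigma> k = \<phi> (fst (\<psi> k), snd (\<psi> k) - 1)" for k
    using inv_f_f[OF inj\<sigma>, of "\<phi> (fst (\<psi> k), snd (\<psi> k) - 1)"] by (simp only: \<sigma>_pred)
  have w: "weight_family w"
    unfolding weight_family_def bdd_above_def
  proof (intro conjI allI exI ballI)
    show "0 < w k" for k using t by (simp add: w_def)
    fix x assume "x \<in> range w"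
    then obtain k where x: "x = w k" by blast
    have nonneg: "0 \<le> sqrt (t i)" for i
      using t[of i] by simp
    then have "sqrt (t i) \<le> (\<Sum>i\<le>m. sqrt (t i))" if "i \<le> m" for i
      using that by (intro member_le_sum) auto
    moreover have "0 \<le> (\<Sum>i\<le>m. sqrt (t i))"
      by (intro sum_nonneg nonneg)
    ultimately show "x \<le> 1 + (\<Sum>i\<le>m. sqrt (t i))"
      by (auto simp: x w_def add_increasing)
  qed
  have normal: "normal_operator N"
    unfolding N_def using inj\<sigma> surj\<sigma>
    by (intro normal_operator_shift_along w) (auto simp: bij_def w_def \<sigma>_def)
  \<comment> \<open>The coefficients of the embedding; they form a unit vector for each \<open>n\<close>.\<close>
  define c where "c i n = sqrt (\<rho> i * t i ^ n / ?\<gamma> n)" for i n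
  have c_sq: "(c i n)\<^sup>2 = \<rho> i * t i ^ n / ?\<gamma> n" for i n
    unfolding c_def using \<rho> t \<gamma>_pos by (intro real_sqrt_pow2) (auto intro!: divide_nonneg_pos mult_nonneg_nonneg less_imp_le)
  have c_sum: "(\<Sum>i\<le>m. (c i n)\<^sup>2) = 1" for n
    using \<gamma>_pos[of m n] by (simp add: c_sq atomic_moment_def flip: sum_divide_distrib)
  have c_Suc: "sqrt (t i) * c i n = c i (Suc n) * ?W n" for i n
    unfolding c_def moment_weight_def real_sqrt_mult[symmetric]
    using \<gamma>_pos[of m n] \<gamma>_pos[of m "Suc n"] by (simp add: field_simps)
  define v where "v f k = (if fst (\<psi> k) \<le> m \<and> 0 \<le> snd (\<psi> k)
      then of_real (c (fst (\<psi> k)) (nat (snd (\<psi> k)))) * coord f (nat (snd (\<psi> k))) else 0)"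
    for f :: "nat ell2" and k
  define V where "V f = Abs_ell2 (v f)" for f
  have v_sum: "((\<lambda>k. (cmod (v f k))\<^sup>2) has_sum (norm f)\<^sup>2) UNIV" for f
  proof -
    let ?h = "\<lambda>(n, i). \<phi> (i, int n)" and ?S = "UNIV \<times> {..m} :: (nat \<times> nat) set"
    let ?F = "\<lambda>(n, i). (c i n)\<^sup>2 * (cmod (coord f n))\<^sup>2"
    have inner: "((\<lambda>i. ?F (n, i)) has_sum (cmod (coord f n))\<^sup>2) {..m}" for n
      using c_sum[of n] by (intro has_sum_finiteI) (simp_all flip: sum_distrib_right)
    have outer: "((\<lambda>n. (cmod (coord f n))\<^sup>2) has_sum (norm f)\<^sup>2) UNIV"
      unfolding norm_ell2_squared by (rule has_sum_infsum[OF square_summable_coord])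
    have "(?F has_sum (norm f)\<^sup>2) ?S"
      by (intro has_sum_SigmaI[OF inner outer] summable_on_SigmaI[OF inner]
          square_summable_coord) auto
    moreover have "(\<lambda>k. (cmod (v f k))\<^sup>2) \<circ> ?h = (\<lambda>(n, i). if i \<le> m then ?F (n, i) else 0)"
      by (auto simp: fun_eq_iff v_def norm_mult power_mult_distrib)
    ultimately have "((\<lambda>k. (cmod (v f k))\<^sup>2) \<circ> ?h has_sum (norm f)\<^sup>2) ?S"
      by (subst has_sum_cong[of _ _ ?F]) auto
    moreover have "inj_on ?h ?S"
      by (auto intro!: inj_onI dest!: injD[OF inj\<phi>])
    ultimately have "((\<lambda>k. (cmod (v f k))\<^sup>2) has_sum (norm f)\<^sup>2) (?h ` ?S)"
      using has_sum_reindex by blast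
    then show ?thesis
    proof (rule has_sum_cong_neutral[THEN iffD1, rotated -1])
      fix k assume k: "k \<in> UNIV - ?h ` ?S"
      have "k = ?h (nat (snd (\<psi> k)), fst (\<psi> k))" if "0 \<le> snd (\<psi> k)"
        using that by simp
      then have "\<not> (fst (\<psi> k) \<le> m \<and> 0 \<le> snd (\<psi> k))"
        using k by blast
      then show "(cmod (v f k))\<^sup>2 = 0"
        by (auto simp: v_def)
    qed auto
  qed
  have coord_V: "coord (V f) k = v f k" for f k
    unfolding V_def using v_sum[of f] by (subst coord_Abs_ell2) (auto simp: summable_on_def)
  have norm_V: "norm (V f) = norm f" for f
  proof -
    have "(norm (V f))\<^sup>2 = (norm f)\<^sup>2"
      unfolding norm_ell2_squared[of "V f"] coord_V using v_sum by (rule infsumI)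
    then show ?thesis by simp
  qed
  have "bounded_linear V"
    by (rule bounded_linear_intro[where K = 1])
      (auto intro!: ell2_eqI simp: coord_V v_def algebra_simps norm_V)
  then have isometry: "clinear_isometry V"
    by (auto simp: clinear_isometry_def bounded_clinear_def norm_V coord_V v_def intro!: ell2_eqI)
  have "N (V f) = V (wshift ?W f)" for f
  proof (rule ell2_eqI)
    fix k
    obtain i n where k: "\<psi> k = (i, n)" by fastforce
    have N: "coord (N (V f)) k = of_real (w k) * v f (\<phi> (i, n - 1))"
      using surj\<sigma> by (simp add: N_def coord_shift_along[OF inj\<sigma> w] inv\<sigma> k coord_V w_def)
    have shift: "coord (wshift ?W f) (Suc p) = of_real (?W p) * coord f p" "coord (wshift ?W f) 0 = 0" for p
      by (simp_all add: wshift_def coord_shift_along[OF inj_Suc W])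
    consider "m < i \<or> n < 0" | "n = 0" | p where "i \<le> m" "n = int (Suc p)"
      by (metis not_less not_gr0 of_nat_0_less_iff less_le zero_less_imp_eq_int of_nat_0 Suc_pred)
    then show "coord (N (V f)) k = coord (V (wshift ?W f)) k"
    proof cases
      case 3
      then have "complex_of_real (w k) * of_real (c i p) = of_real (c i (Suc p)) * of_real (?W p)"
        using c_Suc[of i p] by (simp add: w_def k flip: of_real_mult)
      then show ?thesis
        using 3 by (simp add: N coord_V v_def k shift nat_add_distrib) 
    qed (auto simp: N coord_V v_def k shift)
  qed
  then have "N \<circ> V = V \<circ> wshift ?W" by auto
  then show ?thesis
    unfolding subnormal_def using normal isometry by blast
qed

text \<open>
  Strict Cauchy-Schwarz for consecutive moments, from the Lagrange identity: twice the defect is the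
  sum of \<open>\<rho> i * t i ^ n * \<rho> j * t j ^ n * (t i - t j)^2\<close> over all pairs, and two distinct atoms make
  one of these terms positive.
\<close>

lemma moment_weight_strict_mono:
  assumes \<rho>: "\<And>i. 0 < \<rho> i" and t: "\<And>i. 0 < t i" and ij: "i \<le> m" "j \<le> m" "t i \<noteq> t j"
  shows "moment_weight m \<rho> t n < moment_weight m \<rho> t (Suc n)"
proof -
  let ?\<gamma> = "atomic_moment m \<rho> t"
  note \<gamma>_pos = atomic_moment_pos[of \<rho> t, OF \<rho> t]
  let ?d = "\<lambda>i j. (\<rho> i * t i ^ n) * (\<rho> j * t j ^ n) * (t i - t j)\<^sup>2"
  have nn: "0 \<le> ?d i j" for i j
    by (intro mult_nonneg_nonneg zero_le_power2 zero_le_power less_imp_le \<rho> t)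
  have "0 < ?d i j"
    using ij \<rho> t by (intro mult_pos_pos) auto
  also have "?d i j \<le> (\<Sum>j\<le>m. ?d i j)"
    using ij nn by (intro member_le_sum) auto
  also have "\<dots> \<le> (\<Sum>i\<le>m. \<Sum>j\<le>m. ?d i j)"
    using ij nn by (intro member_le_sum[of i "{..m}" "\<lambda>i. \<Sum>j\<le>m. ?d i j"] sum_nonneg) auto
  also have "\<dots> = (\<Sum>i\<le>m. \<Sum>j\<le>m. (\<rho> i * t i ^ Suc (Suc n)) * (\<rho> j * t j ^ n)
      + (\<rho> i * t i ^ n) * (\<rho> j * t j ^ Suc (Suc n))
      - 2 * ((\<rho> i * t i ^ Suc n) * (\<rho> j * t j ^ Suc n)))"
    by (intro sum.cong refl) (simp add: power2_eq_square algebra_simps)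
  also have "\<dots> = 2 * (?\<gamma> (Suc (Suc n)) * ?\<gamma> n - ?\<gamma> (Suc n) * ?\<gamma> (Suc n))"
    unfolding atomic_moment_def
    by (simp only: sum.distrib sum_subtractf flip: sum_distrib_left sum_distrib_right)
      (simp add: algebra_simps)
  finally have "?\<gamma> (Suc n) * ?\<gamma> (Suc n) < ?\<gamma> (Suc (Suc n)) * ?\<gamma> n" by simp
  then show ?thesis
    unfolding moment_weight_def using \<gamma>_pos[of m n] \<gamma>_pos[of m "Suc n"]
    by (simp add: divide_less_eq less_divide_eq mult_ac)
qed

text \<open>
  With atoms \<open>q ^ (2 * i)\<close> and masses \<open>q ^ - (i^2)\<close>, the atom \<open>i\<close> contributes
  \<open>q ^ (n^2 - (n - i)^2)\<close> to the \<open>n\<close>-th moment. So that moment lies between \<open>q ^ (n^2)\<close> and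
  \<open>(m + 1) * q ^ (n^2)\<close> as long as the atom \<open>i = n\<close> exists, and the second difference of \<open>n^2\<close>
  makes the quotient of consecutive squared weights at least \<open>q^2 / (m + 1)^2\<close>. The moments up to
  \<open>K + 1\<close> enter, hence \<open>m = K + 1\<close>.
\<close>

lemma subnormal_shift_with_steep_start:
  fixes Q :: real
  shows "\<exists>W. weight_family W \<and> subnormal (wshift W) \<and> (\<forall>n. W n < W (Suc n)) \<and>
    (\<forall>n<K. Q * (W n)\<^sup>2 \<le> (W (Suc n))\<^sup>2)"
proof -
  define m where "m = Suc K"
  define q :: real where "q = real (Suc m) * (\<bar>Q\<bar> + 1)"
  have "real (Suc m) * 1 \<le> q"
    unfolding q_def by (rule mult_left_mono) auto
  then have q: "1 < q"
    by (simp add: m_def)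
  define t where "t i = q ^ (2 * i)" for i
  define \<rho> where "\<rho> i = 1 / q ^ (i\<^sup>2)" for i
  let ?\<gamma> = "atomic_moment m \<rho> t"
  have pos: "0 < \<rho> i" "0 < t i" for i
    using q by (auto simp: t_def \<rho>_def)
  note \<gamma>_pos = atomic_moment_pos[of \<rho> t, OF pos]
  have term_eq: "\<rho> i * t i ^ n = q ^ (2 * i * n) / q ^ (i\<^sup>2)" for i n
    by (simp add: \<rho>_def t_def power_mult)
  have lower: "q ^ (n\<^sup>2) \<le> ?\<gamma> n" if "n \<le> m" for n
  proof -
    have "q ^ (n\<^sup>2) = \<rho> n * t n ^ n"
      using q unfolding term_eq
      by (simp add: field_simps power2_eq_square flip: power_add)
    also have "\<dots> \<le> ?\<gamma> n"
      unfolding atomic_moment_def using that pos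
      by (intro member_le_sum) (auto intro!: mult_nonneg_nonneg less_imp_le)
    finally show ?thesis .
  qed
  have upper: "?\<gamma> n \<le> real (Suc m) * q ^ (n\<^sup>2)" for n
  proof -
    have "\<rho> i * t i ^ n \<le> q ^ (n\<^sup>2)" for i
    proof -
      have "2 * i * n \<le> n\<^sup>2 + i\<^sup>2"
      proof (subst of_nat_le_iff[where 'a = real, symmetric])
        show "real (2 * i * n) \<le> real (n\<^sup>2 + i\<^sup>2)"
          using sum_squares_bound[of "real i" "real n"] by simp
      qed
      then have "q ^ (2 * i * n) \<le> q ^ (n\<^sup>2) * q ^ (i\<^sup>2)"
        using q by (simp flip: power_add)
      then show ?thesis
        unfolding term_eq using q by (simp add: divide_le_eq)
    qed
    then have "?\<gamma> n \<le> (\<Sum>i\<le>m. q ^ (n\<^sup>2))"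
      unfolding atomic_moment_def by (intro sum_mono)
    then show ?thesis by simp
  qed
  have "Q * (moment_weight m \<rho> t n)\<^sup>2 \<le> (moment_weight m \<rho> t (Suc n))\<^sup>2" if "n < K" for n
  proof -
    have "n\<^sup>2 + (Suc (Suc n))\<^sup>2 = 2 * (Suc n)\<^sup>2 + 2"
      by (simp add: power2_eq_square)
    then have exps: "q ^ (n\<^sup>2) * q ^ ((Suc (Suc n))\<^sup>2) = q\<^sup>2 * (q ^ ((Suc n)\<^sup>2))\<^sup>2"
      by (simp flip: power_add power_mult add: mult.commute add.commute)
    have "\<bar>Q\<bar> \<le> (\<bar>Q\<bar> + 1)\<^sup>2"
      by (simp add: power2_eq_square algebra_simps)
    then have "Q \<le> (\<bar>Q\<bar> + 1)\<^sup>2" by linarith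
    then have "Q * (?\<gamma> (Suc n))\<^sup>2 \<le> (\<bar>Q\<bar> + 1)\<^sup>2 * (real (Suc m) * q ^ ((Suc n)\<^sup>2))\<^sup>2"
      using upper[of "Suc n"] \<gamma>_pos[of m "Suc n"] by (intro mult_mono power_mono) auto
    also have "\<dots> = q ^ (n\<^sup>2) * q ^ ((Suc (Suc n))\<^sup>2)"
      unfolding exps by (simp add: q_def power_mult_distrib)
    also have "\<dots> \<le> ?\<gamma> n * ?\<gamma> (Suc (Suc n))"
      using q that by (intro mult_mono lower) (auto simp: m_def intro: less_imp_le[OF \<gamma>_pos])
    finally show ?thesis
      using \<gamma>_pos[of m n] \<gamma>_pos[of m "Suc n"] \<gamma>_pos[of m "Suc (Suc n)"]
      by (simp add: moment_weight_def less_imp_le divide_simps power2_eq_square mult_ac)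
  qed
  moreover have "moment_weight m \<rho> t n < moment_weight m \<rho> t (Suc n)" for n
    using less_1_mult[OF q q]
    by (intro moment_weight_strict_mono[of \<rho> t 0 m 1] pos) (auto simp: m_def t_def power2_eq_square)
  ultimately show ?thesis
    using weight_family_moment_weight[of \<rho> t, OF pos] subnormal_moment_weight[of \<rho> t, OF pos]
    by blast
qed


section \<open>Rows with log-convex levels\<close>

text \<open>
  Squared row weights, indexed by the level first. The exponent \<open>(K - j)^2\<close> makes the levels
  log-convex and extends to the value \<open>1\<close> at level \<open>K\<close>, matching the limit of the weights of
  \<open>S_a\<close>.
\<close>

definition row_sq :: "nat \<Rightarrow> real \<Rightarrow> nat \<Rightarrow> nat \<Rightarrow> real"
  where "row_sq K a j i = (if j < K then 4 ^ ((K - j)\<^sup>2) - 1 / (real i + 2)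
    else (S_weights a i)\<^sup>2)"

text \<open>
  The factor by which the squared vertical weight changes along row \<open>j\<close>, from position \<open>0\<close> to
  position \<open>k\<close>, under commutativity.
\<close>

definition row_quot :: "nat \<Rightarrow> real \<Rightarrow> nat \<Rightarrow> nat \<Rightarrow> real"
  where "row_quot K a j k = (\<Prod>i<k. row_sq K a (Suc j) i / row_sq K a j i)"

context
  fixes K :: nat and a :: real
  assumes a: "0 < a" "a < 1"
begin

lemma level_ge_4:
  assumes "j < K"
  shows "(4::real) \<le> 4 ^ ((K - j)\<^sup>2)"
  using assms by (intro self_le_power) auto

lemma row_sq_bounds:
  assumes "j < K"
  shows "4 ^ ((K - j)\<^sup>2) / 2 \<le> row_sq K a j i" "row_sq K a j i \<le> 4 ^ ((K - j)\<^sup>2)"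
    "7 / 2 \<le> row_sq K a j i"
proof -
  have "1 / (real i + 2) \<le> 1 / 2" "0 \<le> 1 / (real i + 2)"
    by (auto simp: divide_simps)
  moreover have "row_sq K a j i = 4 ^ ((K - j)\<^sup>2) - 1 / (real i + 2)"
    using assms by (simp add: row_sq_def)
  ultimately show "4 ^ ((K - j)\<^sup>2) / 2 \<le> row_sq K a j i" "row_sq K a j i \<le> 4 ^ ((K - j)\<^sup>2)"
    "7 / 2 \<le> row_sq K a j i"
    using level_ge_4[OF assms] by linarith+
qed

lemma row_sq_top:
  assumes "K \<le> j"
  shows "row_sq K a j i = (S_weights a i)\<^sup>2"
  using assms by (simp add: row_sq_def)

lemma S_weights_sq: "a\<^sup>2 \<le> (S_weights a i)\<^sup>2" "(S_weights a i)\<^sup>2 \<le> 1" "0 < (S_weights a i)\<^sup>2"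
  using a by (auto simp: S_weights_def power_le_one)

lemma row_sq_pos: "0 < row_sq K a j i"
  using row_sq_bounds(3)[of j i] S_weights_sq(3)[of i]
  by (cases "j < K") (auto simp: row_sq_top)

lemma row_sq_le: "row_sq K a j i \<le> 4 ^ (K\<^sup>2)"
proof (cases "j < K")
  case True
  have "(4::real) ^ ((K - j)\<^sup>2) \<le> 4 ^ (K\<^sup>2)"
    by (intro power_increasing power_mono) auto
  then show ?thesis
    using row_sq_bounds(2)[OF True, of i] by linarith
next
  case False
  have "(1::real) \<le> 4 ^ (K\<^sup>2)" by (intro one_le_power) auto
  then show ?thesis
    using False S_weights_sq(2)[of i] by (auto simp: row_sq_top intro: order_trans)
qed

lemma row_sq_step:
  assumes "j < K"
  shows "row_sq K a j (Suc i) - row_sq K a j i = 1 / ((real i + 2) * (real i + 3))"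
proof -
  have "1 / (real i + 2) - 1 / (real i + 3) = 1 / ((real i + 2) * (real i + 3))"
    by (subst diff_frac_eq) auto
  then show ?thesis
    using assms by (simp add: row_sq_def add.commute)
qed

lemma row_sq_mono: "row_sq K a j i \<le> row_sq K a j (Suc i)"
proof (cases "j < K")
  case True
  then show ?thesis
    using row_sq_step[OF True, of i] by (smt (verit) divide_nonneg_nonneg mult_nonneg_nonneg of_nat_0_le_iff)
next
  case False
  then show ?thesis
    using a S_weights_sq(2)[of i] by (simp add: row_sq_top S_weights_def)
qed

lemma row_sq_antimono: "row_sq K a (Suc j) i \<le> row_sq K a j i"
proof -
  consider "Suc j < K" | "Suc j = K" | "K \<le> j" by linarith
  then show ?thesis
  proof cases
    case 1
    have "(4::real) ^ ((K - Suc j)\<^sup>2) \<le> 4 ^ ((K - j)\<^sup>2)"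
      by (intro power_increasing power_mono) auto
    then show ?thesis using 1 by (simp add: row_sq_def)
  next
    case 2
    then show ?thesis
      using S_weights_sq(2)[of i] row_sq_bounds(3)[of j i] by (simp add: row_sq_top)
  qed (simp add: row_sq_top)
qed

text \<open>
  Below level \<open>K - 1\<close>, the product of the outer levels is \<open>16\<close> times the square of the middle one;
  replacing the levels by squared weights costs a factor \<open>2\<close> for each outer row, and \<open>4 \<ge> 2\<close>
  remains. The factor \<open>(S_weights a i)^2\<close> accounts for the small first weight of \<open>S_a\<close> in case
  the uppermost row is such a row. At level \<open>K - 1\<close> the two upper rows agree, and the bound
  \<open>7 / 2\<close> from below for the squared weights of the Bergman-like row suffices.
\<close>

lemma row_sq_log_convex:
  assumes "j < K"
  shows "2 * (S_weights a i)\<^sup>2 * (row_sq K a (Suc j) i)\<^sup>2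
    \<le> row_sq K a (Suc (Suc j)) i * row_sq K a j i"
proof (cases "Suc j = K")
  case True
  let ?s = "(S_weights a i)\<^sup>2"
  have "?s * ?s \<le> 1"
    using S_weights_sq[of i] by (intro mult_le_one) auto
  then have "2 * (?s * ?s) \<le> row_sq K a j i"
    using row_sq_bounds(3)[OF assms, of i] by linarith
  then have "?s * (2 * (?s * ?s)) \<le> ?s * row_sq K a j i"
    using S_weights_sq(3)[of i] by (intro mult_left_mono) auto
  then show ?thesis
    using True by (simp add: row_sq_top power2_eq_square mult_ac)
next
  case False
  define n where "n = K - Suc (Suc j)"
  have n: "K - j = Suc (Suc n)" "K - Suc j = Suc n" "Suc j < K"
    using assms False by (auto simp: n_def)
  let ?s = "(S_weights a i)\<^sup>2" and ?L = "\<lambda>n. (4::real) ^ (n\<^sup>2)"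
  have exps: "?L n * ?L (Suc (Suc n)) = 16 * (?L (Suc n))\<^sup>2"
  proof -
    have "n\<^sup>2 + (Suc (Suc n))\<^sup>2 = 2 + (Suc n)\<^sup>2 * 2"
      by (simp add: power2_eq_square)
    then have "?L n * ?L (Suc (Suc n)) = 4 ^ (2 + (Suc n)\<^sup>2 * 2)"
      by (simp only: flip: power_add)
    then show ?thesis by (simp add: power_add power_mult)
  qed
  have last: "?s * (?L n / 2) \<le> row_sq K a (Suc (Suc j)) i"
  proof (cases "Suc (Suc j) < K")
    case True
    have "?s * (?L n / 2) \<le> ?L n / 2"
      using S_weights_sq(2)[of i] by (intro mult_left_le_one_le) auto
    also have "\<dots> \<le> row_sq K a (Suc (Suc j)) i"
      unfolding n_def by (rule row_sq_bounds(1)[OF True])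
    finally show ?thesis .
  next
    case False
    then show ?thesis using S_weights_sq(3)[of i] by (simp add: row_sq_top n_def)
  qed
  have "(row_sq K a (Suc j) i)\<^sup>2 \<le> (?L (Suc n))\<^sup>2"
    using row_sq_bounds(2)[OF n(3), of i] row_sq_pos[of "Suc j" i] n(2)
    by (intro power_mono) auto
  then have "2 * ?s * (row_sq K a (Suc j) i)\<^sup>2 \<le> 4 * ?s * (?L (Suc n))\<^sup>2"
    by (rule mult_mono[rotated]) auto
  also have "\<dots> = (?s * (?L n / 2)) * (?L (Suc (Suc n)) / 2)"
    using exps by (simp add: mult_ac)
  also have "\<dots> \<le> row_sq K a (Suc (Suc j)) i * row_sq K a j i"
    using row_sq_bounds(1)[OF assms, of i] n(1) last row_sq_pos[of "Suc (Suc j)" i]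
    by (intro mult_mono) auto
  finally show ?thesis .
qed

lemma row_quot_pos: "0 < row_quot K a j k"
  unfolding row_quot_def by (intro prod_pos ballI divide_pos_pos row_sq_pos)

lemma row_quot_le_1: "row_quot K a j k \<le> 1"
  unfolding row_quot_def
  using row_sq_pos row_sq_antimono by (intro prod_le_1) (auto simp: less_imp_le)

lemma row_quot_top:
  assumes "K \<le> j"
  shows "row_quot K a j k = 1"
  unfolding row_quot_def using assms S_weights_sq(3)
  by (intro prod.neutral) (auto simp: row_sq_top)

lemma row_quot_Suc: "row_quot K a j (Suc k) = row_quot K a j k * (row_sq K a (Suc j) k / row_sq K a j k)"
  by (simp add: row_quot_def)

text \<open>
  The loss \<open>(S_weights a i)^2\<close> in \<open>row_sq_log_convex\<close> differs from \<open>1\<close> only for \<open>i = 0\<close>, so over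
  the whole product it amounts to one factor \<open>a^2\<close>.
\<close>

lemma row_quot_growth:
  assumes "j < K"
  shows "a\<^sup>2 * 2 ^ k * row_quot K a j k \<le> row_quot K a (Suc j) k"
proof -
  have "(\<Prod>i<k. (S_weights a i)\<^sup>2) * 2 ^ k * row_quot K a j k \<le> row_quot K a (Suc j) k"
  proof (induction k)
    case (Suc k)
    let ?x = "row_sq K a j k" and ?y = "row_sq K a (Suc j) k" and ?z = "row_sq K a (Suc (Suc j)) k"
    have step: "2 * (S_weights a k)\<^sup>2 * (?y / ?x) \<le> ?z / ?y"
      using row_sq_log_convex[OF assms, of k] row_sq_pos[of j k] row_sq_pos[of "Suc j" k]
      by (simp add: divide_simps power2_eq_square mult_ac)
    have "((\<Prod>i<k. (S_weights a i)\<^sup>2) * 2 ^ k * row_quot K a j k) * (2 * (S_weights a k)\<^sup>2 * (?y / ?x))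
        \<le> row_quot K a (Suc j) k * (?z / ?y)"
      using row_quot_pos[of "Suc j" k] row_sq_pos[of j k] row_sq_pos[of "Suc j" k]
      by (intro mult_mono Suc.IH step) (auto simp: less_imp_le)
    then show ?case
      by (simp add: row_quot_Suc mult_ac)
  qed (simp add: row_quot_def)
  moreover have "a\<^sup>2 \<le> (\<Prod>i<k. (S_weights a i)\<^sup>2)"
  proof (cases k)
    case 0
    then show ?thesis using a by (simp add: power_le_one)
  next
    case (Suc n)
    then show ?thesis
      unfolding Suc prod.lessThan_Suc_shift by (simp add: S_weights_def)
  qed
  ultimately show ?thesis
    using row_quot_pos[of j k] by (smt (verit) mult_right_mono zero_le_power)
qed

lemma sub_exponential: "(real k + 2) * (real k + 3) \<le> 6 * 2 ^ k"
proof (induction k)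
  case (Suc k)
  have "(real (Suc k) + 2) * (real (Suc k) + 3) \<le> 2 * ((real k + 2) * (real k + 3))"
    by (simp add: algebra_simps)
  then show ?case using Suc by simp
qed simp

text \<open>
  With \<open>u\<close> and \<open>v\<close> the squares of two consecutive weights of the zeroth column, this is the
  determinant condition of the six-point test at a Bergman-like row, solved for the upper vertical
  weight; the factor \<open>(k + 2) * (k + 3)\<close> is the reciprocal of the increment in \<open>row_sq_step\<close>. The
  constant: the squared weights are at most \<open>M = 4 ^ (K^2)\<close> and those of row \<open>j\<close> exceed \<open>1/2\<close>,
  so the quotient of squared difference and lower row is at most \<open>2 * M^2\<close>; and \<open>6 * 2^k\<close>
  dominates \<open>(k + 2) * (k + 3)\<close>.
\<close>

lemma column_weight_gap:
  assumes "j < K" and u: "0 \<le> u"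
    and step: "(1 + 12 * (4 ^ (K\<^sup>2))\<^sup>2) / a\<^sup>2 * u \<le> v"
  shows "u * row_quot K a j k * (1 + (row_sq K a (Suc j) k - row_sq K a j k)\<^sup>2 / row_sq K a j k
      * ((real k + 2) * (real k + 3))) \<le> v * row_quot K a (Suc j) k"
proof -
  let ?x = "row_sq K a j k" and ?y = "row_sq K a (Suc j) k" and ?M = "(4::real) ^ (K\<^sup>2)"
    and ?P = "row_quot K a j k"
  have "(?y - ?x)\<^sup>2 \<le> ?M\<^sup>2"
    using row_sq_pos[of j k] row_sq_pos[of "Suc j" k] row_sq_le[of j k] row_sq_le[of "Suc j" k]
    by (intro abs_le_square_iff[THEN iffD1]) auto
  then have "(?y - ?x)\<^sup>2 / ?x \<le> ?M\<^sup>2 / (1 / 2)"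
    using row_sq_bounds(3)[OF assms(1), of k] by (intro frac_le) auto
  also have "\<dots> = 2 * ?M\<^sup>2"
    by simp
  finally have dev: "(?y - ?x)\<^sup>2 / ?x \<le> 2 * ?M\<^sup>2" .
  then have "(?y - ?x)\<^sup>2 / ?x * ((real k + 2) * (real k + 3)) \<le> 2 * ?M\<^sup>2 * (6 * 2 ^ k)"
    by (intro mult_mono sub_exponential) auto
  also have "1 + \<dots> \<le> (1 + 12 * ?M\<^sup>2) * 2 ^ k"
    by (simp add: algebra_simps)
  finally have "1 + (?y - ?x)\<^sup>2 / ?x * ((real k + 2) * (real k + 3)) \<le> (1 + 12 * ?M\<^sup>2) * 2 ^ k"
    by simp
  then have "u * ?P * (1 + (?y - ?x)\<^sup>2 / ?x * ((real k + 2) * (real k + 3)))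
      \<le> u * ?P * ((1 + 12 * ?M\<^sup>2) * 2 ^ k)"
    using u row_quot_pos[of j k] by (intro mult_left_mono) auto
  also have "\<dots> = ((1 + 12 * ?M\<^sup>2) / a\<^sup>2 * u) * (a\<^sup>2 * 2 ^ k * ?P)"
    using a by simp
  also have "\<dots> \<le> v * row_quot K a (Suc j) k"
    using u a row_quot_pos[of j k] order_trans[OF _ step]
    by (intro mult_mono step row_quot_growth assms(1)) (auto simp: less_imp_le)
  finally show ?thesis .
qed

end

section \<open>Existence of the hyponormal pair\<close>

theorem theorem3p14:
  fixes k2 :: nat and \<alpha>0 :: real
  assumes "k2 \<ge> 1" and "0 < \<alpha>0" and "\<alpha>0 < 1"
  shows "\<exists>(l :: nat \<Rightarrow> nat) (W :: nat \<Rightarrow> real).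
    (\<forall>i<k2. 1 \<le> l i) \<and>
    weight_family W \<and> subnormal (wshift W) \<and> (\<forall>n. W n < W (Suc n)) \<and>
    (\<exists>\<alpha> \<beta> :: nat \<times> nat \<Rightarrow> real.
       weight_family \<alpha> \<and> weight_family \<beta> \<and> commuting_weights \<alpha> \<beta> \<and>
       (\<forall>j<k2. \<forall>k. \<alpha> (k, j) = bergman_like_weights (real (l j)) k) \<and>
       (\<forall>j\<ge>k2. \<forall>k. \<alpha> (k, j) = S_weights \<alpha>0 k) \<and>
       (\<forall>j. \<beta> (0, j) = W j) \<and>
       jointly_hyponormal (shift1 \<alpha>) (shift2 \<beta>))"
proof -
  note a = assms(2,3)
  let ?x = "row_sq k2 \<alpha>0" and ?P = "row_quot k2 \<alpha>0"
  note x_pos = row_sq_pos[OF a, of k2] and P_pos = row_quot_pos[OF a, of k2]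
  obtain W where W: "weight_family W" "subnormal (wshift W)" "\<And>n. W n < W (Suc n)"
    and steep: "\<And>n. n < k2 \<Longrightarrow> (1 + 12 * (4 ^ (k2\<^sup>2))\<^sup>2) / \<alpha>0\<^sup>2 * (W n)\<^sup>2 \<le> (W (Suc n))\<^sup>2"
    using subnormal_shift_with_steep_start[of k2 "(1 + 12 * (4 ^ (k2\<^sup>2))\<^sup>2) / \<alpha>0\<^sup>2"] by blast
  obtain B where B: "\<And>n. 0 < W n" "\<And>n. W n \<le> B"
    using W(1) by (auto simp: weight_family_def bdd_above_def)
  define l :: "nat \<Rightarrow> nat" where "l j = 4 ^ ((k2 - j)\<^sup>2)" for j
  define \<alpha> :: "nat \<times> nat \<Rightarrow> real" where "\<alpha> = (\<lambda>(k, j). sqrt (?x j k))"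
  define \<beta> :: "nat \<times> nat \<Rightarrow> real" where "\<beta> = (\<lambda>(k, j). W j * sqrt (?P j k))"
  have \<alpha>_sq: "(\<alpha> (k, j))\<^sup>2 = ?x j k" and \<beta>_sq: "(\<beta> (k, j))\<^sup>2 = (W j)\<^sup>2 * ?P j k" for k j
    using x_pos[of j k] P_pos[of j k] by (simp_all add: \<alpha>_def \<beta>_def power_mult_distrib)
  have \<alpha>: "weight_family \<alpha>"
    unfolding weight_family_def bdd_above_def
    using x_pos row_sq_le[OF a, of k2] by (auto simp: \<alpha>_def intro!: exI[of _ "sqrt (4 ^ (k2\<^sup>2))"])
  have "\<beta> (k, j) \<le> B" for k j
  proof -
    have "W j * sqrt (?P j k) \<le> W j * 1"
      using row_quot_le_1[OF a, of k2 j k] B(1)[of j] by (intro mult_left_mono) auto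
    then show ?thesis using B(2)[of j] by (simp add: \<beta>_def)
  qed
  then have \<beta>: "weight_family \<beta>"
    unfolding weight_family_def bdd_above_def using B(1) P_pos by (auto simp: \<beta>_def)
  have \<beta>_Suc: "\<beta> (Suc k, j) = \<alpha> (k, Suc j) * \<beta> (k, j) / \<alpha> (k, j)" for k j
    by (simp add: \<alpha>_def \<beta>_def row_quot_Suc[OF a] real_sqrt_mult real_sqrt_divide)
  have \<alpha>_pos: "0 < \<alpha> p" for p
    using \<alpha> unfolding weight_family_def by blast
  have comm: "commuting_weights \<alpha> \<beta>"
    unfolding commuting_weights_def using \<alpha>_pos by (simp add: \<beta>_Suc less_imp_neq[symmetric])
  \<comment> \<open>Monotonicity up the columns, and the determinant condition in terms of squared weights.\<close>
  have key: "(W j)\<^sup>2 * ?P j k \<le> (W (Suc j))\<^sup>2 * ?P (Suc j) k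
      \<and> (W j)\<^sup>2 * ?P j k * ((?x (Suc j) k - ?x j k)\<^sup>2 / ?x j k)
        \<le> (?x j (Suc k) - ?x j k) * ((W (Suc j))\<^sup>2 * ?P (Suc j) k - (W j)\<^sup>2 * ?P j k)" for j k
  proof (cases "j < k2")
    case True
    define u where "u = (W j)\<^sup>2 * ?P j k"
    define v where "v = (W (Suc j))\<^sup>2 * ?P (Suc j) k"
    define D where "D = (?x (Suc j) k - ?x j k)\<^sup>2 / ?x j k"
    define m where "m = (real k + 2) * (real k + 3)"
    have nonneg: "0 \<le> u" "0 \<le> D" "0 < m"
      using P_pos[of j k] x_pos[of j k] by (auto simp: u_def D_def m_def)
    have gap: "u + u * D * m \<le> v"
      using column_weight_gap[OF a True _ steep[OF True], of k]
      by (simp add: u_def v_def D_def m_def algebra_simps)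
    have "u * D \<le> 1 / m * (v - u)"
      using gap nonneg by (simp add: field_simps)
    moreover have "u \<le> v"
      using gap nonneg by (smt (verit) mult_nonneg_nonneg)
    moreover have "?x j (Suc k) - ?x j k = 1 / m"
      unfolding m_def by (rule row_sq_step[OF a True])
    ultimately show ?thesis
      by (simp add: u_def v_def D_def)
  next
    case False
    have "(W j)\<^sup>2 \<le> (W (Suc j))\<^sup>2"
      using W(3)[of j] B(1)[of j] by (intro power_mono) auto
    then show ?thesis
      using False row_sq_mono[OF a, of k2 j k] by (simp add: row_quot_top[OF a] row_sq_top[OF a])
  qed
  have det: "(\<alpha> (k, Suc j) * \<beta> (Suc k, j) - \<alpha> (k, j) * \<beta> (k, j))\<^sup>2
      \<le> ((\<alpha> (Suc k, j))\<^sup>2 - (\<alpha> (k, j))\<^sup>2) * ((\<beta> (k, Suc j))\<^sup>2 - (\<beta> (k, j))\<^sup>2)" for k j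
  proof -
    have "\<alpha> (k, Suc j) * \<beta> (Suc k, j) - \<alpha> (k, j) * \<beta> (k, j)
        = \<beta> (k, j) * ((\<alpha> (k, Suc j))\<^sup>2 - (\<alpha> (k, j))\<^sup>2) / \<alpha> (k, j)"
      using \<alpha>_pos[of "(k, j)"] by (simp add: \<beta>_Suc field_simps power2_eq_square)
    then have "(\<alpha> (k, Suc j) * \<beta> (Suc k, j) - \<alpha> (k, j) * \<beta> (k, j))\<^sup>2
        = (W j)\<^sup>2 * ?P j k * ((?x (Suc j) k - ?x j k)\<^sup>2 / ?x j k)"
      by (simp add: power_divide power_mult_distrib \<alpha>_sq \<beta>_sq)
    then show ?thesis
      using key by (simp add: \<alpha>_sq \<beta>_sq)
  qed
  have "jointly_hyponormal (shift1 \<alpha>) (shift2 \<beta>)"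
    unfolding shift1_def shift2_def
  proof (rule six_point_test[OF inj_steps \<alpha> \<beta>])
    show "shift_along (\<lambda>(k1, k2). (Suc k1, k2)) \<alpha> \<circ> shift_along (\<lambda>(k1, k2). (k1, Suc k2)) \<beta>
        = shift_along (\<lambda>(k1, k2). (k1, Suc k2)) \<beta> \<circ> shift_along (\<lambda>(k1, k2). (Suc k1, k2)) \<alpha>"
      using commuting_shifts_iff[OF \<alpha> \<beta>] comm by (simp add: shift1_def shift2_def)
    show "range (\<lambda>(k1 :: nat, k2 :: nat). (Suc k1, k2)) \<inter> range (\<lambda>(k1, k2). (k1, Suc k2))
        \<subseteq> range ((\<lambda>(k1, k2). (Suc k1, k2)) \<circ> (\<lambda>(k1, k2). (k1, Suc k2)))"
      by (auto simp: image_iff)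
  qed (use key det row_sq_mono[OF a, of k2] in \<open>auto simp: \<alpha>_sq \<beta>_sq split: prod.splits\<close>)
  moreover have "\<forall>j<k2. \<forall>k. \<alpha> (k, j) = bergman_like_weights (real (l j)) k"
    by (simp add: \<alpha>_def row_sq_def bergman_like_weights_def l_def)
  moreover have "\<forall>j\<ge>k2. \<forall>k. \<alpha> (k, j) = S_weights \<alpha>0 k"
    using a by (simp add: \<alpha>_def row_sq_top[OF a] S_weights_def)
  moreover have "\<forall>j. \<beta> (0, j) = W j"
    by (simp add: \<beta>_def row_quot_def)
  moreover have "\<forall>i<k2. 1 \<le> l i"
    by (simp add: l_def)
  ultimately show ?thesis
    using W \<alpha> \<beta> comm by blast
qed

end
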